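(* Let $V$ be a separable infinite-dimensional right quaternionic Hilbert space, let $T\in\mathcal{B}(V)$ and let $n\ge 1$ be an integer. Then $$\sigma_e^S(T^n)=\{q^n\in\mathbb{H}:\ q\in\sigma_e^S(T)\}.$$
   Context: $\mathbb{H}$ is the skew field of quaternions. A right quaternionic Hilbert space $V$ is a right $\mathbb{H}$-vector space with an $\mathbb{H}$-valued inner product satisfying $\langle f,gq+h\rangle=\langle f,g\rangle q+\langle f,h\rangle$, $\langle f,g\rangle=\overline{\langle g,f\rangle}$, $\langle f,f\rangle\ge 0$ with equality only for $f=0$, and complete for $\|f\|=\sqrt{\langle f,f\rangle}$. $\mathcal{B}(V)$ is the set of bounded right $\mathbb{H}$-linear operators on $V$ and $\mathcal{K}(V)$ the closed two-sided ideal of compact ones. For $T\in\mathcal{B}(V)$ and $q\in\mathbb{H}$, $Q_q(T):=T^2-2\operatorname{Re}(q)T+|q|^2\mathbb{I}_V$. The essential $S$-spectrum $\sigma_e^S(T)$ is the set of $q\in\mathbb{H}$ such that the class of $Q_q(T)$ is not invertible in the Calkin algebra $\mathcal{B}(V)/\mathcal{K}(V)$; equivalently, $Q_q(T)$ is not Fredholm (Fredholm meaning finite-dimensional null space and finite-dimensional $V/R(Q_q(T))$, where $R(\cdot)$ denotes the range). *)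

theory Defs
  imports "HOL-Analysis.Analysis" "HOL-Algebra.QuotRing"
begin

section \<open>Quaternions\<close>

text \<open>\<open>Quat a b c d\<close> stands for \<open>a + b i + c j + d k\<close>.\<close>

datatype quat = Quat (qre: real) (qim1: real) (qim2: real) (qim3: real)

lemma quat_eq_iff:
  "x = y \<longleftrightarrow> qre x = qre y \<and> qim1 x = qim1 y \<and> qim2 x = qim2 y \<and> qim3 x = qim3 y"
  by (auto intro: quat.expand)

instantiation quat :: "{zero, one, plus, minus, uminus, times, inverse, scaleR, norm}"
begin

definition "0 = Quat 0 0 0 0"
definition "1 = Quat 1 0 0 0"
definition "x + y = Quat (qre x + qre y) (qim1 x + qim1 y) (qim2 x + qim2 y) (qim3 x + qim3 y)"
definition "x - y = Quat (qre x - qre y) (qim1 x - qim1 y) (qim2 x - qim2 y) (qim3 x - qim3 y)"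
definition "- x = Quat (- qre x) (- qim1 x) (- qim2 x) (- qim3 x)"

text \<open>The multiplication table \<open>i\<^sup>2 = j\<^sup>2 = k\<^sup>2 = -1\<close>, \<open>ij = k = -ji\<close>, \<open>jk = i = -kj\<close>, \<open>ki = j = -ik\<close>.\<close>

definition "x * y = Quat
   (qre x * qre y - qim1 x * qim1 y - qim2 x * qim2 y - qim3 x * qim3 y)
   (qre x * qim1 y + qim1 x * qre y + qim2 x * qim3 y - qim3 x * qim2 y)
   (qre x * qim2 y - qim1 x * qim3 y + qim2 x * qre y + qim3 x * qim1 y)
   (qre x * qim3 y + qim1 x * qim2 y - qim2 x * qim1 y + qim3 x * qre y)"

definition "r *\<^sub>R x = Quat (r * qre x) (r * qim1 x) (r * qim2 x) (r * qim3 x)"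
definition "norm x = sqrt ((qre x)\<^sup>2 + (qim1 x)\<^sup>2 + (qim2 x)\<^sup>2 + (qim3 x)\<^sup>2)"
definition "inverse x = (1 / ((qre x)\<^sup>2 + (qim1 x)\<^sup>2 + (qim2 x)\<^sup>2 + (qim3 x)\<^sup>2)) *\<^sub>R
   Quat (qre x) (- qim1 x) (- qim2 x) (- qim3 x)"
definition "x div y = x * inverse (y :: quat)"

instance ..

end

lemmas quat_ring_defs =
  zero_quat_def one_quat_def plus_quat_def minus_quat_def uminus_quat_def times_quat_def
  scaleR_quat_def

instantiation quat :: real_normed_div_algebra
begin

definition "sgn (x :: quat) = x /\<^sub>R norm x"
definition "dist x y = norm (x - y :: quat)"
definition "(uniformity :: (quat \<times> quat) filter) = (INF e\<in>{0<..}. principal {(x, y). dist x y < e})"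
definition "open U \<longleftrightarrow> (\<forall>x\<in>U. eventually (\<lambda>(x', y). x' = x \<longrightarrow> y \<in> U) (uniformity :: (quat \<times> quat) filter))"

instance
proof
  fix x y z :: quat and r s :: real
  show "x + y + z = x + (y + z)" "x + y = y + x" "0 + x = x" "- x + x = 0" "x - y = x + - y"
    "r *\<^sub>R (x + y) = r *\<^sub>R x + r *\<^sub>R y" "(r + s) *\<^sub>R x = r *\<^sub>R x + s *\<^sub>R x"
    "r *\<^sub>R s *\<^sub>R x = (r * s) *\<^sub>R x" "1 *\<^sub>R x = x"
    "x * y * z = x * (y * z)" "1 * x = x" "x * 1 = x"
    "(x + y) * z = x * z + y * z" "x * (y + z) = x * y + x * z"
    "(0 :: quat) \<noteq> 1" "r *\<^sub>R x * y = r *\<^sub>R (x * y)" "x * r *\<^sub>R y = r *\<^sub>R (x * y)"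
    by (simp_all add: quat_ring_defs algebra_simps)
  have norm_quat_eq_norm_Pair: "norm x = norm ((qre x, qim1 x), (qim2 x, qim3 x))" for x :: quat
    by (simp add: norm_quat_def norm_Pair)
  show "inverse x * x = 1" "x * inverse x = 1" if "x \<noteq> 0"
  proof -
    define N where "N = (qre x)\<^sup>2 + (qim1 x)\<^sup>2 + (qim2 x)\<^sup>2 + (qim3 x)\<^sup>2"
    have "N \<noteq> 0"
      using that by (auto simp: N_def quat_eq_iff zero_quat_def add_nonneg_eq_0_iff)
    then have "1 / N * N = 1" by simp
    then obtain a where a: "1 / N = a" "a * N = 1" by blast
    have inv: "inverse x = a *\<^sub>R Quat (qre x) (- qim1 x) (- qim2 x) (- qim3 x)"
      by (simp add: inverse_quat_def a flip: N_def)
    show "inverse x * x = 1" "x * inverse x = 1"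
      using a(2) unfolding inv N_def
      by (simp_all add: quat_ring_defs algebra_simps power2_eq_square)
  qed
  show "x div y = x * inverse y" by (fact divide_quat_def)
  show "inverse (0 :: quat) = 0" by (simp add: inverse_quat_def quat_ring_defs)
  show "dist x y = norm (x - y)" by (fact dist_quat_def)
  show "sgn x = x /\<^sub>R norm x" by (fact sgn_quat_def)
  show "(uniformity :: (quat \<times> quat) filter) = (INF e\<in>{0<..}. principal {(x, y). dist x y < e})"
    by (fact uniformity_quat_def)
  show "open U \<longleftrightarrow> (\<forall>x\<in>U. \<forall>\<^sub>F (x', y) in uniformity. x' = x \<longrightarrow> y \<in> U)" for U :: "quat set"
    by (fact open_quat_def)
  show "norm x = 0 \<longleftrightarrow> x = 0"
    by (simp add: norm_quat_eq_norm_Pair zero_prod_def quat_eq_iff) (auto simp: zero_quat_def)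
  show "norm (x + y) \<le> norm x + norm y"
    using norm_triangle_ineq[of "((qre x, qim1 x), (qim2 x, qim3 x))" "((qre y, qim1 y), (qim2 y, qim3 y))"]
    by (simp add: norm_quat_eq_norm_Pair plus_quat_def)
  show "norm (r *\<^sub>R x) = \<bar>r\<bar> * norm x"
    by (simp add: norm_quat_def scaleR_quat_def power_mult_distrib real_sqrt_mult flip: distrib_left)
  show "norm (x * y) = norm x * norm y"
    unfolding norm_quat_def real_sqrt_mult[symmetric]
    by (rule arg_cong[of _ _ sqrt]) (simp add: times_quat_def power2_eq_square algebra_simps)
qed

end

definition qcnj :: "quat \<Rightarrow> quat"
  where "qcnj q = Quat (qre q) (- qim1 q) (- qim2 q) (- qim3 q)"


section \<open>Right quaternionic Hilbert spaces\<close>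

text \<open>
  The norm and the real scalar multiplication are determined by the quaternionic structure
  (axioms \<open>norm_eq_sqrt_qinner\<close> and \<open>scaleR_eq_scaleQ\<close>); they are class parameters only so that the
  metric and topological notions of the library apply. By \<open>qinner_commute\<close> the quaternion
  \<open>qinner x x\<close> is real, so \<open>qinner_ge_zero\<close> says that it is a non-negative real.
\<close>

class right_quat_inner = real_normed_vector +
  fixes scaleQ :: "'a \<Rightarrow> quat \<Rightarrow> 'a" (infixl "*\<^sub>Q" 75)
    and qinner :: "'a \<Rightarrow> 'a \<Rightarrow> quat"
  assumes scaleQ_add_left: "(x + y) *\<^sub>Q p = x *\<^sub>Q p + y *\<^sub>Q p"
    and scaleQ_add_right: "x *\<^sub>Q (p + q) = x *\<^sub>Q p + x *\<^sub>Q q"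
    and scaleQ_scaleQ: "x *\<^sub>Q p *\<^sub>Q q = x *\<^sub>Q (p * q)"
    and scaleQ_one: "x *\<^sub>Q 1 = x"
    and scaleR_eq_scaleQ: "r *\<^sub>R x = x *\<^sub>Q of_real r"
    and qinner_right_linear: "qinner x (y *\<^sub>Q q + z) = qinner x y * q + qinner x z"
    and qinner_commute: "qinner x y = qcnj (qinner y x)"
    and qinner_ge_zero: "0 \<le> qre (qinner x x)"
    and qinner_eq_zero_iff: "qinner x x = 0 \<longleftrightarrow> x = 0"
    and norm_eq_sqrt_qinner: "norm x = sqrt (qre (qinner x x))"

class right_quat_hilbert = right_quat_inner + complete_space

definition infinite_quat_dim :: "'a::right_quat_inner itself \<Rightarrow> bool"
  where "infinite_quat_dim _ \<longleftrightarrow>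
    \<not> (\<exists>B :: 'a set. finite B \<and> (\<forall>x. \<exists>c. x = (\<Sum>b\<in>B. b *\<^sub>Q c b)))"


section \<open>Bounded and compact operators, the Calkin algebra\<close>

definition bounded_quat_linear :: "('a::right_quat_inner \<Rightarrow> 'a) \<Rightarrow> bool"
  where "bounded_quat_linear T \<longleftrightarrow>
    (\<forall>x y. T (x + y) = T x + T y) \<and> (\<forall>x q. T (x *\<^sub>Q q) = T x *\<^sub>Q q) \<and>
    (\<exists>K. \<forall>x. norm (T x) \<le> K * norm x)"

definition bounded_ops :: "('a::right_quat_inner \<Rightarrow> 'a) ring"
  where "bounded_ops =
    \<lparr>carrier = {T. bounded_quat_linear T}, mult = (\<circ>), one = id,
     zero = (\<lambda>_. 0), add = (\<lambda>S T x. S x + T x)\<rparr>"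

definition compact_ops :: "('a::right_quat_inner \<Rightarrow> 'a) set"
  where "compact_ops = {T. bounded_quat_linear T \<and> compact (closure (T ` cball 0 1))}"

definition calkin_algebra :: "('a::right_quat_inner \<Rightarrow> 'a) set ring"
  where "calkin_algebra = bounded_ops Quot compact_ops"

definition calkin_class :: "('a::right_quat_inner \<Rightarrow> 'a) \<Rightarrow> ('a \<Rightarrow> 'a) set"
  where "calkin_class T = compact_ops +>\<^bsub>bounded_ops\<^esub> T"

lemma bounded_quat_linear_scaleR:
  "bounded_quat_linear T \<Longrightarrow> T (r *\<^sub>R x) = r *\<^sub>R T x"
  by (simp add: bounded_quat_linear_def scaleR_eq_scaleQ)

lemma bounded_quat_linear_imp_bounded_linear:
  assumes "bounded_quat_linear T"
  shows "bounded_linear T"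
proof -
  obtain K where "\<And>x. norm (T x) \<le> K * norm x"
    using assms by (auto simp: bounded_quat_linear_def)
  then show ?thesis
    using assms bounded_quat_linear_scaleR[OF assms]
    by (intro bounded_linear_intro[of T K]) (auto simp: bounded_quat_linear_def mult.commute)
qed

lemma bounded_quat_linear_iff:
  "bounded_quat_linear T \<longleftrightarrow> bounded_linear T \<and> (\<forall>x q. T (x *\<^sub>Q q) = T x *\<^sub>Q q)"
proof (intro iffI conjI)
  assume "bounded_linear T \<and> (\<forall>x q. T (x *\<^sub>Q q) = T x *\<^sub>Q q)"
  then show "bounded_quat_linear T"
    unfolding bounded_quat_linear_def
    by (auto simp: linear_add bounded_linear.linear dest: bounded_linear.bounded)
       (metis bounded_linear.bounded mult.commute)
qed (auto simp: bounded_quat_linear_imp_bounded_linear bounded_quat_linear_def)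

lemma scaleQ_zero_left: "(0 :: 'a::right_quat_inner) *\<^sub>Q q = 0"
  using scaleQ_add_left[of "0::'a" 0 q] by simp

lemma scaleQ_minus_left: "(- x :: 'a::right_quat_inner) *\<^sub>Q q = - (x *\<^sub>Q q)"
  using scaleQ_add_left[of x "-x" q] by (simp add: scaleQ_zero_left eq_neg_iff_add_eq_0 add.commute)

lemma bounded_quat_linear_zero: "bounded_quat_linear (\<lambda>_. 0)"
  by (simp add: bounded_quat_linear_iff scaleQ_zero_left)

lemma bounded_quat_linear_id: "bounded_quat_linear id"
  by (simp add: bounded_quat_linear_iff id_def)

lemma bounded_quat_linear_add:
  "bounded_quat_linear S \<Longrightarrow> bounded_quat_linear T \<Longrightarrow> bounded_quat_linear (\<lambda>x. S x + T x)"
  by (simp add: bounded_quat_linear_iff bounded_linear_add scaleQ_add_left)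

lemma bounded_quat_linear_minus:
  "bounded_quat_linear T \<Longrightarrow> bounded_quat_linear (\<lambda>x. - T x)"
  by (simp add: bounded_quat_linear_iff bounded_linear_minus scaleQ_minus_left)

lemma bounded_quat_linear_comp:
  "bounded_quat_linear S \<Longrightarrow> bounded_quat_linear T \<Longrightarrow> bounded_quat_linear (S \<circ> T)"
  by (simp add: bounded_quat_linear_iff bounded_linear_compose comp_def)

lemma ring_bounded_ops: "Ring.ring (bounded_ops :: ('a::right_quat_inner \<Rightarrow> 'a) ring)"
proof (rule ringI)
  show "abelian_group (bounded_ops :: ('a \<Rightarrow> 'a) ring)"
  proof (rule abelian_groupI)
    fix T :: "'a \<Rightarrow> 'a" assume "T \<in> carrier bounded_ops"
    then show "\<exists>S\<in>carrier bounded_ops. S \<oplus>\<^bsub>bounded_ops\<^esub> T = \<zero>\<^bsub>bounded_ops\<^esub>"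
      by (intro bexI[of _ "\<lambda>x. - T x"]) (auto simp: bounded_ops_def bounded_quat_linear_minus)
  qed (auto simp: bounded_ops_def bounded_quat_linear_add bounded_quat_linear_zero add_ac)
  show "monoid (bounded_ops :: ('a \<Rightarrow> 'a) ring)"
    by (rule monoidI)
       (auto simp: bounded_ops_def bounded_quat_linear_comp bounded_quat_linear_id comp_assoc)
qed (auto simp: bounded_ops_def bounded_quat_linear_def fun_eq_iff)

lemma compact_ops_iff:
  "T \<in> compact_ops \<longleftrightarrow> bounded_quat_linear T \<and> (\<exists>C. compact C \<and> T ` cball 0 1 \<subseteq> C)"
proof -
  have "compact (closure A)" if "compact C" "A \<subseteq> C" for A C :: "'a set"
    using that by (metis closed_closure closure_minimal compact_Int_closed compact_imp_closed inf.absorb2)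
  then show ?thesis
    unfolding compact_ops_def mem_Collect_eq by (metis closure_subset)
qed

lemma ideal_compact_ops:
  "ideal compact_ops (bounded_ops :: ('a::right_quat_inner \<Rightarrow> 'a) ring)"
proof (rule idealI)
  interpret Ring.ring "bounded_ops :: ('a \<Rightarrow> 'a) ring" by (rule ring_bounded_ops)
  have minus: "inv\<^bsub>add_monoid bounded_ops\<^esub> T = (\<lambda>x. - T x)" if "bounded_quat_linear T" for T :: "'a \<Rightarrow> 'a"
    using that minus_equality[of "\<lambda>x. - T x" T]
    by (simp add: a_inv_def bounded_ops_def bounded_quat_linear_minus)
  show "subgroup compact_ops (add_monoid (bounded_ops :: ('a \<Rightarrow> 'a) ring))"
  proof (rule add.subgroupI)
    show "compact_ops \<subseteq> carrier (bounded_ops :: ('a \<Rightarrow> 'a) ring)"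
      by (auto simp: bounded_ops_def compact_ops_def)
    have "(\<lambda>_. 0) \<in> (compact_ops :: ('a \<Rightarrow> 'a) set)"
      by (auto simp: compact_ops_iff bounded_quat_linear_zero intro: exI[of _ "{0}"])
    then show "(compact_ops :: ('a \<Rightarrow> 'a) set) \<noteq> {}" by auto
  next
    fix S :: "'a \<Rightarrow> 'a" assume S: "S \<in> compact_ops"
    then obtain C where C: "bounded_quat_linear S" "compact C" "S ` cball 0 1 \<subseteq> C"
      by (auto simp: compact_ops_iff)
    then have "compact (uminus ` C)" "(\<lambda>x. - S x) ` cball 0 1 \<subseteq> uminus ` C"
      using compact_negations by (auto simp: image_subset_iff)
    then have "(\<lambda>x. - S x) \<in> compact_ops"
      using C bounded_quat_linear_minus by (auto simp only: compact_ops_iff)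
    then show "\<ominus>\<^bsub>bounded_ops\<^esub> S \<in> compact_ops"
      using minus C by (simp add: a_inv_def)
  next
    fix S T :: "'a \<Rightarrow> 'a" assume "S \<in> compact_ops" "T \<in> compact_ops"
    then obtain C D where C: "bounded_quat_linear S" "compact C" "S ` cball 0 1 \<subseteq> C"
      and D: "bounded_quat_linear T" "compact D" "T ` cball 0 1 \<subseteq> D"
      by (auto simp: compact_ops_iff)
    have "(\<lambda>x. S x + T x) ` cball 0 1 \<subseteq> {x + y | x y. x \<in> C \<and> y \<in> D}"
      using C D by blast
    moreover have "compact {x + y | x y. x \<in> C \<and> y \<in> D}"
      using compact_sums C D by blast
    ultimately have "(\<lambda>x. S x + T x) \<in> compact_ops"
      using C D bounded_quat_linear_add by (auto simp only: compact_ops_iff)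
    then show "S \<oplus>\<^bsub>bounded_ops\<^esub> T \<in> compact_ops"
      by (simp add: bounded_ops_def)
  qed
  fix T S :: "'a \<Rightarrow> 'a" assume "T \<in> compact_ops" "S \<in> carrier bounded_ops"
  then obtain C where C: "bounded_quat_linear T" "compact C" "T ` cball 0 1 \<subseteq> C"
    and S: "bounded_quat_linear S"
    by (auto simp: compact_ops_iff bounded_ops_def)
  have "compact (S ` C)"
    using S C by (intro compact_continuous_image linear_continuous_on
        bounded_quat_linear_imp_bounded_linear)
  moreover have "(S \<circ> T) ` cball 0 1 \<subseteq> S ` C"
    using C by auto
  ultimately show "S \<otimes>\<^bsub>bounded_ops\<^esub> T \<in> compact_ops"
    using C S bounded_quat_linear_comp by (auto simp: compact_ops_iff bounded_ops_def)
  obtain K where K: "K > 0" "\<And>x. norm (S x) \<le> norm x * K"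
    using bounded_linear.pos_bounded[OF bounded_quat_linear_imp_bounded_linear[OF S]] by blast
  have "(T \<circ> S) ` cball 0 1 \<subseteq> (*\<^sub>R) K ` C"
  proof clarsimp
    fix x :: 'a assume "norm x \<le> 1"
    then have "norm (S x) \<le> K"
      using K by (smt (verit) mult_left_le_one_le norm_ge_zero)
    then have "T (S x /\<^sub>R K) \<in> C"
      using K C(3) by (auto simp: image_subset_iff field_simps)
    moreover have "T (S x) = K *\<^sub>R T (S x /\<^sub>R K)"
      using K(1) by (simp add: bounded_quat_linear_scaleR[OF C(1)])
    ultimately show "T (S x) \<in> (*\<^sub>R) K ` C" by blast
  qed
  then show "T \<otimes>\<^bsub>bounded_ops\<^esub> S \<in> compact_ops"
    using C S bounded_quat_linear_comp compact_scaling[OF C(2), of K]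
    by (auto simp: compact_ops_iff bounded_ops_def)
qed (rule ring_bounded_ops)


section \<open>The essential S-spectrum\<close>

definition Q_op :: "quat \<Rightarrow> ('a::right_quat_inner \<Rightarrow> 'a) \<Rightarrow> 'a \<Rightarrow> 'a"
  where "Q_op q T = (\<lambda>x. (T ^^ 2) x - (2 * qre q) *\<^sub>R T x + (norm q)\<^sup>2 *\<^sub>R x)"

definition ess_S_spectrum :: "('a::right_quat_inner \<Rightarrow> 'a) \<Rightarrow> quat set"
  where "ess_S_spectrum T = {q. calkin_class (Q_op q T) \<notin> Units calkin_algebra}"

end

theory Submission
  imports Defs "HOL-Computational_Algebra.Fundamental_Theorem_Algebra"
begin

text \<open>
  If \<open>w\<^sub>1, \<dots>, w\<^sub>n\<close> are the complex \<open>n\<close>-th roots of \<open>z\<close>, then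
  \<open>X\<^sup>2\<^sup>n - 2 Re z X\<^sup>n + |z|\<^sup>2\<close> is the product of the real quadratic polynomials
  \<open>X\<^sup>2 - 2 Re w\<^sub>j X + |w\<^sub>j|\<^sup>2\<close>, because at a real point \<open>x\<close> both sides equal
  \<open>|x\<^sup>n - z|\<^sup>2\<close>. Substituting \<open>T\<close> writes \<open>Q\<^sub>p(T\<^sup>n)\<close> as a product of the commuting operators
  \<open>Q\<^sub>q(T)\<close>, where \<open>q\<close> runs through the \<open>n\<close>-th roots of \<open>p\<close> in a complex slice of the quaternions
  that contains \<open>p\<close>. A product of commuting elements of a ring is a unit if and only if
  every factor is.
\<close>

section \<open>Complex slices of the quaternions\<close>

text \<open>If \<open>I * I = -1\<close>, this is the embedding of the complex numbers into the
  quaternions that sends the imaginary unit to \<open>I\<close>.\<close>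

definition slice :: "quat \<Rightarrow> complex \<Rightarrow> quat"
  where "slice I z = of_real (Re z) + Im z *\<^sub>R I"

lemma of_real_quat: "of_real r = Quat r 0 0 0"
  by (simp add: of_real_def quat_ring_defs)

lemma slice_mult:
  assumes "I * I = -1"
  shows "slice I (z * w) = slice I z * slice I w"
proof -
  have "slice I z * slice I w = of_real (Re z * Re w) + (Re z * Im w + Im z * Re w) *\<^sub>R I
      + (Im z * Im w) *\<^sub>R (I * I)"
    by (simp add: slice_def of_real_def algebra_simps)
  then show ?thesis
    by (simp add: assms slice_def of_real_def algebra_simps)
qed

lemma slice_power:
  assumes "I * I = -1"
  shows "slice I (z ^ n) = slice I z ^ n"
  by (induction n) (simp_all add: slice_mult[OF assms], simp add: slice_def)

text \<open>Divide the imaginary part of \<open>q\<close> by its length to get the imaginary unit. A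
  real \<open>q\<close> lies in every slice, so there an arbitrary unit serves.\<close>

lemma quat_in_slice:
  obtains a b c z where "a\<^sup>2 + b\<^sup>2 + c\<^sup>2 = 1" "q = slice (Quat 0 a b c) z"
proof (cases "qim1 q = 0 \<and> qim2 q = 0 \<and> qim3 q = 0")
  case True
  then have "q = slice (Quat 0 1 0 0) (Complex (qre q) 0)"
    by (simp add: slice_def of_real_quat quat_eq_iff quat_ring_defs)
  then show ?thesis using that[of 1 0 0] by simp
next
  case False
  define v where "v = sqrt ((qim1 q)\<^sup>2 + (qim2 q)\<^sup>2 + (qim3 q)\<^sup>2)"
  have "(qim1 q)\<^sup>2 + (qim2 q)\<^sup>2 + (qim3 q)\<^sup>2 \<noteq> 0"
    using False by (auto simp: add_nonneg_eq_0_iff)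
  then have v: "v \<noteq> 0" "v\<^sup>2 = (qim1 q)\<^sup>2 + (qim2 q)\<^sup>2 + (qim3 q)\<^sup>2"
    by (auto simp: v_def)
  show ?thesis
  proof (rule that)
    show "(qim1 q / v)\<^sup>2 + (qim2 q / v)\<^sup>2 + (qim3 q / v)\<^sup>2 = 1"
      using v(1) by (simp add: power_divide flip: add_divide_distrib v(2))
    show "q = slice (Quat 0 (qim1 q / v) (qim2 q / v) (qim3 q / v)) (Complex (qre q) v)"
      using v by (simp add: slice_def of_real_quat quat_eq_iff quat_ring_defs)
  qed
qed

lemma unit_imaginary_square:
  assumes "a\<^sup>2 + b\<^sup>2 + c\<^sup>2 = 1"
  shows "Quat 0 a b c * Quat 0 a b c = -1"
  using assms by (simp add: quat_ring_defs power2_eq_square algebra_simps)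

lemma qre_slice: "qre (slice (Quat 0 a b c) z) = Re z"
  by (simp add: slice_def of_real_quat quat_ring_defs)

lemma norm_slice:
  assumes "a\<^sup>2 + b\<^sup>2 + c\<^sup>2 = 1"
  shows "norm (slice (Quat 0 a b c) z) = cmod z"
proof -
  have "(Re z)\<^sup>2 + (Im z * a)\<^sup>2 + (Im z * b)\<^sup>2 + (Im z * c)\<^sup>2
      = (Re z)\<^sup>2 + (Im z)\<^sup>2 * (a\<^sup>2 + b\<^sup>2 + c\<^sup>2)"
    by (simp add: power_mult_distrib algebra_simps)
  then show ?thesis
    by (simp add: assms slice_def of_real_quat quat_ring_defs norm_quat_def cmod_def)
qed


section \<open>Real polynomials in an operator\<close>

text \<open>Horner's scheme for \<open>p(T)\<close>, so that induction over \<open>pCons\<close>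
  applies.\<close>

definition op_poly :: "real poly \<Rightarrow> ('a::real_vector \<Rightarrow> 'a) \<Rightarrow> 'a \<Rightarrow> 'a"
  where "op_poly p T = fold_coeffs (\<lambda>a f x. a *\<^sub>R x + T (f x)) p (\<lambda>_. 0)"

lemma op_poly_0 [simp]: "op_poly 0 T x = 0"
  by (simp add: op_poly_def)

lemma op_poly_pCons:
  assumes "linear T"
  shows "op_poly (pCons a p) T x = a *\<^sub>R x + T (op_poly p T x)"
  \<comment> \<open>\<open>pCons 0 0\<close> is \<open>0\<close> and leaves nothing to fold; this
    case rests on \<open>T 0 = 0\<close>.\<close>
  using linear_0[OF assms]
  by (cases "a = 0 \<and> p = 0") (auto simp: op_poly_def)

lemma op_poly_1:
  assumes "linear T"
  shows "op_poly 1 T x = x"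
  by (simp add: one_pCons op_poly_pCons[OF assms] linear_0[OF assms])

lemma op_poly_add:
  assumes "linear T"
  shows "op_poly (p + q) T x = op_poly p T x + op_poly q T x"
  by (induction p q rule: poly_induct2)
     (simp_all add: op_poly_pCons[OF assms] linear_add[OF assms] scaleR_add_left)

lemma op_poly_smult:
  assumes "linear T"
  shows "op_poly (smult a p) T x = a *\<^sub>R op_poly p T x"
  by (induction p)
     (simp_all add: op_poly_pCons[OF assms] linear_cmul[OF assms] scaleR_add_right)

lemma op_poly_mult:
  assumes "linear T"
  shows "op_poly (p * q) T x = op_poly p T (op_poly q T x)"
  by (induction p)
     (simp_all add: op_poly_pCons[OF assms] op_poly_add[OF assms] op_poly_smult[OF assms])

lemma op_poly_monom:
  assumes "linear T"
  shows "op_poly (monom a n) T x = a *\<^sub>R (T ^^ n) x"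
  by (induction n)
     (simp_all add: op_poly_pCons[OF assms] linear_0[OF assms] linear_cmul[OF assms]
       monom_0 monom_Suc)

lemma bounded_quat_linear_imp_linear: "bounded_quat_linear T \<Longrightarrow> linear T"
  by (simp add: bounded_linear.linear bounded_quat_linear_imp_bounded_linear)

lemma bounded_quat_linear_op_poly:
  assumes "bounded_quat_linear T"
  shows "bounded_quat_linear (op_poly p T)"
proof (induction p)
  case 0
  then show ?case by (simp add: op_poly_def bounded_quat_linear_zero)
next
  case (pCons a p)
  \<comment> \<open>Real scalars are central in the quaternions, so scaling by them is right linear;
    this is why the coefficients are real.\<close>
  have "bounded_quat_linear (\<lambda>x. a *\<^sub>R x)"
    unfolding bounded_quat_linear_iff
    by (simp add: bounded_linear_scaleR_right) (simp add: scaleR_eq_scaleQ scaleQ_scaleQ of_real_def)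
  then have "bounded_quat_linear (\<lambda>x. a *\<^sub>R x + (T \<circ> op_poly p T) x)"
    using pCons assms by (intro bounded_quat_linear_add bounded_quat_linear_comp)
  then show ?case
    by (simp add: op_poly_pCons[OF bounded_quat_linear_imp_linear[OF assms], abs_def])
qed


section \<open>Factorization\<close>

text \<open>The polynomial \<open>(X - w)(X - cnj w)\<close>.\<close>

definition root_quadratic :: "complex \<Rightarrow> real poly"
  where "root_quadratic w = [:(cmod w)\<^sup>2, - 2 * Re w, 1:]"

lemma poly_root_quadratic: "poly (root_quadratic w) x = (cmod (of_real x - w))\<^sup>2"
proof -
  have "poly (root_quadratic w) x = (cmod w)\<^sup>2 - 2 * Re w * x + x\<^sup>2"
    by (simp add: root_quadratic_def power2_eq_square algebra_simps)
  then show ?thesis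
    by (simp add: cmod_power2 power2_diff)
qed

lemma poly_prod_mset_root_quadratic:
  "poly (\<Prod>w\<in>#A. root_quadratic w) x = (cmod (poly (\<Prod>w\<in>#A. [:-w, 1:]) (of_real x)))\<^sup>2"
  by (simp add: poly_prod_mset, induction A)
     (simp_all add: poly_root_quadratic norm_mult power_mult_distrib)

text \<open>\<open>A\<close> has to be a multiset: for \<open>z = 0\<close> the only root
  \<open>0\<close> occurs \<open>n\<close> times.\<close>

lemma root_quadratic_pcompose_monom:
  assumes "n \<ge> 1"
  obtains A where "set_mset A = {w. w ^ n = z}"
    "pcompose (root_quadratic z) (monom 1 n) = (\<Prod>w\<in>#A. root_quadratic w)"
proof -
  let ?p = "monom 1 n - [:z:]"
  have deg: "degree ?p = n"
  proof -
    have "degree (monom 1 n + [:-z:]) = degree (monom (1::complex) n)"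
      using assms by (intro degree_add_eq_left) (simp add: degree_monom_eq)
    then show ?thesis by (simp add: degree_monom_eq diff_conv_add_uminus del: add_uminus_conv_diff)
  qed
  \<comment> \<open>Being monic removes the scalar in front of the product of linear
    factors.\<close>
  then have "lead_coeff ?p = 1"
    using assms by (simp add: coeff_pCons split: nat.split)
  moreover have "?p \<noteq> 0" using deg assms by auto
  ultimately obtain A where A: "?p = (\<Prod>w\<in>#A. [:-w, 1:])"
    using alg_closed_imp_factorization[of ?p] by auto
  show ?thesis
  proof
    have "w \<in># A \<longleftrightarrow> poly (\<Prod>w\<in>#A. [:-w, 1:]) w = 0" for w
      by (induction A) auto
    then show "set_mset A = {w. w ^ n = z}"
      by (auto simp: poly_monom simp flip: A)
    have "poly (pcompose (root_quadratic z) (monom 1 n)) x = poly (\<Prod>w\<in>#A. root_quadratic w) x" for x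
      by (simp add: poly_prod_mset_root_quadratic poly_pcompose poly_root_quadratic poly_monom flip: A)
    then show "pcompose (root_quadratic z) (monom 1 n) = (\<Prod>w\<in>#A. root_quadratic w)"
      by (simp add: poly_eq_poly_eq_iff[symmetric] fun_eq_iff)
  qed
qed


section \<open>Units of the Calkin algebra\<close>

text \<open>If \<open>c\<close> inverts \<open>x \<otimes> y\<close>, then
  \<open>y \<otimes> c\<close> is a right inverse of \<open>x\<close> and, by commutation,
  \<open>c \<otimes> y\<close> is a left inverse; the two must agree. By symmetry \<open>y\<close>
  is a unit too.\<close>

lemma (in monoid) commuting_mult_Units_iff:
  assumes "a \<in> carrier G" "b \<in> carrier G" "a \<otimes> b = b \<otimes> a"
  shows "a \<otimes> b \<in> Units G \<longleftrightarrow> a \<in> Units G \<and> b \<in> Units G"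
proof
  have *: "x \<in> Units G"
    if xy: "x \<in> carrier G" "y \<in> carrier G" "x \<otimes> y = y \<otimes> x" "x \<otimes> y \<in> Units G" for x y
  proof -
    obtain c where c: "c \<in> carrier G" "c \<otimes> (x \<otimes> y) = \<one>" "(x \<otimes> y) \<otimes> c = \<one>"
      using xy(4) by (auto simp: Units_def)
    have r: "x \<otimes> (y \<otimes> c) = \<one>"
      using c(1,3) xy(1,2) by (simp add: m_assoc)
    have l: "(c \<otimes> y) \<otimes> x = \<one>"
      using c(1,2) xy(1,2) by (simp add: m_assoc xy(3))
    with r have "c \<otimes> y = y \<otimes> c"
      using inv_unique[of "c \<otimes> y" x "y \<otimes> c"] xy(1,2) c(1) by simp
    then show ?thesis
      using r l xy(1,2) c(1) unfolding Units_def by auto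
  qed
  assume "a \<otimes> b \<in> Units G"
  then show "a \<in> Units G \<and> b \<in> Units G"
    using *[of a b] *[of b a] assms by auto
qed auto

lemma calkin_class_hom:
  "calkin_class \<in> ring_hom (bounded_ops :: ('a::right_quat_inner \<Rightarrow> 'a) ring) calkin_algebra"
  using ideal.rcos_ring_hom[OF ideal_compact_ops]
  unfolding calkin_class_def[abs_def] calkin_algebra_def .

lemma ring_calkin_algebra:
  "Ring.ring (calkin_algebra :: ('a::right_quat_inner \<Rightarrow> 'a) set ring)"
  unfolding calkin_algebra_def by (rule ideal.quotient_is_ring[OF ideal_compact_ops])

abbreviation calkin_unit :: "('a::right_quat_inner \<Rightarrow> 'a) \<Rightarrow> bool"
  where "calkin_unit S \<equiv> calkin_class S \<in> Units calkin_algebra"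

lemma calkin_unit_op_poly_mult:
  fixes T :: "'a::right_quat_inner \<Rightarrow> 'a"
  assumes "bounded_quat_linear T"
  shows "calkin_unit (op_poly (p * q) T) \<longleftrightarrow> calkin_unit (op_poly p T) \<and> calkin_unit (op_poly q T)"
proof -
  interpret C: Ring.ring "calkin_algebra :: ('a \<Rightarrow> 'a) set ring" by (rule ring_calkin_algebra)
  have lin: "linear T" using assms by (rule bounded_quat_linear_imp_linear)
  have carr: "op_poly r T \<in> carrier bounded_ops" for r
    using bounded_quat_linear_op_poly[OF assms] by (simp add: bounded_ops_def)
  have hom: "calkin_class (op_poly (r * s) T)
      = calkin_class (op_poly r T) \<otimes>\<^bsub>calkin_algebra\<^esub> calkin_class (op_poly s T)" for r s
  proof -
    have "op_poly (r * s) T = op_poly r T \<otimes>\<^bsub>bounded_ops\<^esub> op_poly s T"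
      by (simp add: bounded_ops_def fun_eq_iff op_poly_mult[OF lin])
    then show ?thesis
      using ring_hom_mult[OF calkin_class_hom carr carr] by simp
  qed
  show ?thesis
    unfolding hom
  proof (rule C.commuting_mult_Units_iff)
    show "calkin_class (op_poly p T) \<otimes>\<^bsub>calkin_algebra\<^esub> calkin_class (op_poly q T) =
        calkin_class (op_poly q T) \<otimes>\<^bsub>calkin_algebra\<^esub> calkin_class (op_poly p T)"
      \<comment> \<open>Commutation is inherited from multiplication of real polynomials.\<close>
      by (simp add: mult.commute flip: hom)
  qed (intro ring_hom_closed[OF calkin_class_hom carr])+
qed

lemma calkin_unit_op_poly_prod_mset:
  fixes T :: "'a::right_quat_inner \<Rightarrow> 'a"
  assumes "bounded_quat_linear T"
  shows "calkin_unit (op_poly (\<Prod>x\<in>#A. f x) T) \<longleftrightarrow> (\<forall>x\<in>#A. calkin_unit (op_poly (f x) T))"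
proof (induction A)
  case empty
  interpret C: Ring.ring "calkin_algebra :: ('a \<Rightarrow> 'a) set ring" by (rule ring_calkin_algebra)
  have "op_poly 1 T = \<one>\<^bsub>bounded_ops\<^esub>"
    using op_poly_1[OF bounded_quat_linear_imp_linear[OF assms]]
    by (simp add: bounded_ops_def fun_eq_iff)
  then show ?case
    by (simp add: ring_hom_one[OF calkin_class_hom])
qed (simp add: calkin_unit_op_poly_mult[OF assms])


section \<open>The spectral mapping theorem\<close>

text \<open>\<open>Q_op\<close> sees only the real part and the norm of the quaternion, and the
  slice embedding preserves both.\<close>

lemma Q_op_slice:
  assumes "linear T" "a\<^sup>2 + b\<^sup>2 + c\<^sup>2 = 1"
  shows "Q_op (slice (Quat 0 a b c) z) T = op_poly (root_quadratic z) T"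
  by (simp add: Q_op_def fun_eq_iff qre_slice norm_slice[OF assms(2)] root_quadratic_def
      op_poly_pCons[OF assms(1)] linear_add[OF assms(1)] linear_cmul[OF assms(1)]
      linear_0[OF assms(1)] linear_diff[OF assms(1)] numeral_2_eq_2)

lemma Q_op_slice_power:
  assumes "linear T" "a\<^sup>2 + b\<^sup>2 + c\<^sup>2 = 1"
  shows "Q_op (slice (Quat 0 a b c) z) (T ^^ n) = op_poly (pcompose (root_quadratic z) (monom 1 n)) T"
proof -
  \<comment> \<open>Each monomial evaluates to a power of \<open>T\<close>; the exponent
    \<open>n + n\<close> matches the square of \<open>T ^^ n\<close>.\<close>
  have "pcompose (root_quadratic z) (monom 1 n)
      = monom ((cmod z)\<^sup>2) 0 + (monom (- 2 * Re z) n + monom 1 (n + n))"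
    by (simp add: root_quadratic_def pcompose_pCons monom_0 mult_monom smult_monom algebra_simps)
  then show ?thesis
    by (simp add: Q_op_def fun_eq_iff qre_slice norm_slice[OF assms(2)] op_poly_add[OF assms(1)]
        op_poly_monom[OF assms(1)] numeral_2_eq_2 funpow_add)
qed

text \<open>Spectral mapping inside one slice: the product of the factors fails to be a unit exactly
  when some factor does.\<close>

lemma slice_power_in_ess_S_spectrum_iff:
  assumes "bounded_quat_linear T" "n \<ge> 1" "a\<^sup>2 + b\<^sup>2 + c\<^sup>2 = 1"
  shows "slice (Quat 0 a b c) z \<in> ess_S_spectrum (T ^^ n) \<longleftrightarrow>
    (\<exists>w. w ^ n = z \<and> slice (Quat 0 a b c) w \<in> ess_S_spectrum T)"
proof -
  have lin: "linear T" using assms(1) by (rule bounded_quat_linear_imp_linear)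
  obtain A where A: "set_mset A = {w. w ^ n = z}"
    "pcompose (root_quadratic z) (monom 1 n) = (\<Prod>w\<in>#A. root_quadratic w)"
    using root_quadratic_pcompose_monom[OF assms(2)] by blast
  show ?thesis
    unfolding ess_S_spectrum_def mem_Collect_eq Q_op_slice_power[OF lin assms(3)]
      Q_op_slice[OF lin assms(3)] A(2) calkin_unit_op_poly_prod_mset[OF assms(1)]
    using A(1) by blast
qed

theorem theorem4p9:
  fixes T :: "'a::right_quat_hilbert \<Rightarrow> 'a" and n :: nat
  assumes "separable_space (euclidean :: 'a topology)"
    and "infinite_quat_dim TYPE('a)"
    and "bounded_quat_linear T"
    and "n \<ge> 1"
  shows "ess_S_spectrum (T ^^ n) = {q ^ n | q. q \<in> ess_S_spectrum T}"
proof (intro Set.set_eqI iffI)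
  fix p assume p: "p \<in> ess_S_spectrum (T ^^ n)"
  obtain a b c z where I: "a\<^sup>2 + b\<^sup>2 + c\<^sup>2 = 1" "p = slice (Quat 0 a b c) z"
    by (rule quat_in_slice)
  then obtain w where "w ^ n = z" "slice (Quat 0 a b c) w \<in> ess_S_spectrum T"
    using p slice_power_in_ess_S_spectrum_iff[OF assms(3,4) I(1)] by auto
  then show "p \<in> {q ^ n | q. q \<in> ess_S_spectrum T}"
    using I slice_power[OF unit_imaginary_square[OF I(1)]] by auto
next
  fix p assume "p \<in> {q ^ n | q. q \<in> ess_S_spectrum T}"
  then obtain q where q: "p = q ^ n" "q \<in> ess_S_spectrum T" by blast
  \<comment> \<open>The slice is taken through \<open>q\<close>, not \<open>p\<close>: it then
    contains \<open>q ^ n\<close>, whereas a slice through a real \<open>p\<close> may miss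
    \<open>q\<close>.\<close>
  obtain a b c w where I: "a\<^sup>2 + b\<^sup>2 + c\<^sup>2 = 1" "q = slice (Quat 0 a b c) w"
    by (rule quat_in_slice)
  then have "p = slice (Quat 0 a b c) (w ^ n)"
    using q slice_power[OF unit_imaginary_square[OF I(1)]] by simp
  then show "p \<in> ess_S_spectrum (T ^^ n)"
    using q I slice_power_in_ess_S_spectrum_iff[OF assms(3,4) I(1)] by auto
qed

end
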